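(* Let $e_k\in\mathbb{R}[x_1,\dots,x_n]$ be the elementary symmetric polynomial of degree $k$ and let $h\in\mathbb{R}[x_1,\dots,x_n]$ be a nonzero homogeneous multiaffine stable polynomial of degree $k$. If $v\in H(e_k)$, then there exists a permutation $\tau\in\mathfrak{S}_n$ such that $\tau(v)\in H(h)$.
   Context: $\mathfrak{S}_n$ is the symmetric group, acting on $\mathbb{R}^n$ by permuting coordinates. $e_k=\sum_{J\subseteq\{1,\dots,n\},|J|=k}\prod_{i\in J}x_i$. A polynomial is multiaffine if it is a linear combination of square-free monomials, and stable if it does not vanish at any $(z_1,\dots,z_n)\in\mathbb{C}^n$ with all $z_i$ having positive imaginary part. A homogeneous stable polynomial $p$ is hyperbolic with respect to $\mathbf 1=(1,\dots,1)$, i.e. $p(\mathbf 1)\ne0$ and $p(v-t\mathbf 1)$ has only real roots in $t$ for every $v\in\mathbb{R}^n$; $H(p)$ is the set of $v\in\mathbb{R}^n$ such that all roots of $p(v-t\mathbf 1)$ are nonnegative. *)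

theory Defs
  imports "HOL-Analysis.Analysis" "HOL-Library.Poly_Mapping"
begin

text \<open>
  Polynomials in \<open>\<real>[x\<^sub>1, \<dots>, x\<^sub>n]\<close> are elements of the monoid algebra of exponent vectors;
  the variables are indexed by a finite type \<open>'n\<close> with \<open>CARD('n) = n\<close>.
\<close>

type_synonym 'n rpoly = "('n \<Rightarrow>\<^sub>0 nat) \<Rightarrow>\<^sub>0 real"

definition Var :: "'n \<Rightarrow> 'n rpoly" where
  "Var i = Poly_Mapping.single (Poly_Mapping.single i 1) 1"

definition elem_sym :: "nat \<Rightarrow> ('n::finite) rpoly" where
  "elem_sym k = (\<Sum>J | card J = k. \<Prod>i\<in>J. Var i)"

definition eval_rpoly :: "('n::finite) rpoly \<Rightarrow> complex ^ 'n \<Rightarrow> complex" where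
  "eval_rpoly p z = (\<Sum>m\<in>Poly_Mapping.keys p.
     of_real (Poly_Mapping.lookup p m) * (\<Prod>i\<in>UNIV. z $ i ^ Poly_Mapping.lookup m i))"

definition homogeneous :: "nat \<Rightarrow> ('n::finite) rpoly \<Rightarrow> bool" where
  "homogeneous k p \<longleftrightarrow> (\<forall>m\<in>Poly_Mapping.keys p. (\<Sum>i\<in>UNIV. Poly_Mapping.lookup m i) = k)"

definition multiaffine :: "('n::finite) rpoly \<Rightarrow> bool" where
  "multiaffine p \<longleftrightarrow> (\<forall>m\<in>Poly_Mapping.keys p. \<forall>i. Poly_Mapping.lookup m i \<le> 1)"

definition stable_rpoly :: "('n::finite) rpoly \<Rightarrow> bool" where
  "stable_rpoly p \<longleftrightarrow> (\<forall>z. (\<forall>i. Im (z $ i) > 0) \<longrightarrow> eval_rpoly p z \<noteq> 0)"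

text \<open>
  The roots of the univariate polynomial \<open>p(v - t\<one>)\<close> are its complex roots, and
  each of them is required to be a nonnegative real number. For \<open>p\<close> hyperbolic with respect to
  \<open>\<one>\<close> all of these roots are real anyway.
\<close>

definition hyp_cone :: "('n::finite) rpoly \<Rightarrow> (real ^ 'n) set" where
  "hyp_cone p = {v. \<forall>t. eval_rpoly p (\<chi> i. of_real (v $ i) - t) = 0 \<longrightarrow> t \<in> \<real>\<^sub>\<ge>\<^sub>0}"

definition perm_vec :: "('n \<Rightarrow> 'n) \<Rightarrow> real ^ 'n \<Rightarrow> real ^ ('n::finite)" where
  "perm_vec \<tau> v = (\<chi> i. v $ (inv \<tau> i))"

end

theory Submission
  imports Defs "HOL-Computational_Algebra.Fundamental_Theorem_Algebra"
begin

text \<open>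
  Why the theorem is true.  Replacing \<open>h\<close> by a lazy transposition \<open>(1 - \<theta>) h + \<theta> \<tau>h\<close>, with \<open>\<tau>\<close>
  exchanging two variables and \<open>0 \<le> \<theta> \<le> 1\<close>, has two properties.

  It preserves stability (\<open>ma_stable_lazy_swap\<close>).  In the two variables concerned this says that
  if a biaffine \<open>f\<close> does not vanish on \<open>H \<times> H\<close>, \<open>H\<close> the upper half plane, then neither does
  \<open>(1 - \<theta>) f(x, y) + \<theta> f(y, x)\<close>.  A Moebius map sending a zero of \<open>f(t, t)\<close> to infinity removes
  the term in \<open>xy\<close> and maps \<open>H\<close> onto a convex region; for an affine \<open>f\<close> the average is a value
  of \<open>f\<close> at a point of the same region.

  Its hyperbolicity cone contains no points that are new up to the exchange: if \<open>v\<close> lies in the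
  cone of the average, then \<open>v\<close> or \<open>\<tau>(v)\<close> lies in the cone of \<open>h\<close> (\<open>in_ma_cone_lazy_swap\<close>).
  The restrictions of \<open>h\<close> and \<open>\<tau>h\<close> to the line \<open>v + s\<one>\<close> are, after normalization, monic
  polynomials in \<open>s\<close> all of whose convex combinations have only real roots, because these come from
  stable polynomials.  If one member of such a pencil has no nonnegative root, the same holds for
  one of the two ends (\<open>no_nonneg_root_endpoint\<close>): a real-rooted monic polynomial with no nonnegative root has
  only positive coefficients, the coefficients vary linearly, and nonnegative coefficients with a
  positive constant term already exclude nonnegative roots.

  Finitely many lazy transpositions turn \<open>h\<close> into a polynomial invariant under all permutations
  (\<open>symmetrization_exists\<close>).  Being multiaffine, homogeneous and stable, it is a nonzero multiple
  of \<open>e\<^sub>k\<close>.  Following \<open>v \<in> H(e\<^sub>k)\<close> back through the steps, one obtains the permutation.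
\<close>

section \<open>Multiaffine polynomials as functions on subsets\<close>

abbreviation swap :: "'n \<Rightarrow> 'n \<Rightarrow> 'n \<Rightarrow> 'n" where
  "swap \<equiv> Transposition.transpose"

text \<open>
  A multiaffine polynomial is stored as the function that maps \<open>J\<close> to the coefficient of
  \<open>\<Prod>i\<in>J. x\<^sub>i\<close>.  Averaging and permuting variables are then operations on functions, and
  symmetry becomes a statement about sets of equal cardinality.
\<close>

definition ma_eval :: "('n::finite set \<Rightarrow> real) \<Rightarrow> ('n \<Rightarrow> complex) \<Rightarrow> complex" where
  "ma_eval c z = (\<Sum>J\<in>UNIV. of_real (c J) * (\<Prod>i\<in>J. z i))"

definition ma_stable :: "nat \<Rightarrow> ('n::finite set \<Rightarrow> real) \<Rightarrow> bool" where
  "ma_stable k c \<longleftrightarrow> (\<forall>J. c J \<noteq> 0 \<longrightarrow> card J = k) \<and>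
     (\<forall>z. (\<forall>i. Im (z i) > 0) \<longrightarrow> ma_eval c z \<noteq> 0)"

definition in_ma_cone :: "('n::finite set \<Rightarrow> real) \<Rightarrow> ('n \<Rightarrow> real) \<Rightarrow> bool" where
  "in_ma_cone c v \<longleftrightarrow> (\<forall>t. ma_eval c (\<lambda>i. of_real (v i) - t) = 0 \<longrightarrow> t \<in> \<real>\<^sub>\<ge>\<^sub>0)"

definition lazy_swap :: "real \<Rightarrow> 'n \<Rightarrow> 'n \<Rightarrow> ('n set \<Rightarrow> real) \<Rightarrow> 'n set \<Rightarrow> real" where
  "lazy_swap \<theta> a b c J = (1 - \<theta>) * c J + \<theta> * c (swap a b ` J)"

lemma ma_eval_lincomb:
  "ma_eval (\<lambda>J. x * c J + y * d J) z = of_real x * ma_eval c z + of_real y * ma_eval d z"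
  by (simp add: ma_eval_def sum.distrib sum_distrib_left algebra_simps)

lemma ma_eval_transpose:
  "ma_eval (\<lambda>J. c (swap a b ` J)) z = ma_eval c (z \<circ> swap a b)"
proof -
  let ?t = "swap a b"
  have "ma_eval c (z \<circ> ?t) = (\<Sum>J\<in>UNIV. of_real (c (?t ` J)) * (\<Prod>i\<in>?t ` J. z (?t i)))"
    unfolding ma_eval_def comp_def
    by (rule sum.reindex_bij_witness[of _ "image ?t" "image ?t"]) (auto simp: image_image)
  also have "\<dots> = (\<Sum>J\<in>UNIV. of_real (c (?t ` J)) * (\<Prod>i\<in>J. z i))"
  proof (rule sum.cong[OF refl])
    fix J
    have "(\<Prod>i\<in>?t ` J. z (?t i)) = (\<Prod>i\<in>J. z i)"
      by (subst prod.reindex) (auto simp: inj_on_def dest: injD[OF inj_transpose])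
    then show "complex_of_real (c (?t ` J)) * (\<Prod>i\<in>?t ` J. z (?t i)) =
        complex_of_real (c (?t ` J)) * (\<Prod>i\<in>J. z i)" by simp
  qed
  finally show ?thesis by (simp add: ma_eval_def)
qed

lemma ma_eval_lazy_swap:
  "ma_eval (lazy_swap \<theta> a b c) z =
     of_real (1 - \<theta>) * ma_eval c z + of_real \<theta> * ma_eval c (z \<circ> swap a b)"
proof -
  have "lazy_swap \<theta> a b c = (\<lambda>J. (1 - \<theta>) * c J + \<theta> * c (swap a b ` J))"
    by (rule ext) (simp add: lazy_swap_def)
  then show ?thesis by (simp only: ma_eval_lincomb ma_eval_transpose)
qed

lemma ma_eval_cnj: "ma_eval c (\<lambda>i. cnj (z i)) = cnj (ma_eval c z)"
  by (simp add: ma_eval_def)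

text \<open>
  A point \<open>v + s\<one>\<close> with non-real \<open>s\<close> has all coordinates in one open half plane; real coefficients
  carry stability over to the lower one.
\<close>

lemma ma_eval_real_root:
  assumes "ma_stable k c" and "ma_eval c (\<lambda>i. of_real (v i) + s) = 0"
  shows "Im s = 0"
proof (rule ccontr)
  assume "Im s \<noteq> 0"
  then consider "Im s > 0" | "Im s < 0" by linarith
  then show False
  proof cases
    case 1
    then show False using assms by (auto simp: ma_stable_def)
  next
    case 2
    have "ma_eval c (\<lambda>i. cnj (of_real (v i) + s)) = 0"
      using assms(2) by (subst ma_eval_cnj) simp
    moreover have "\<forall>i. Im (cnj (of_real (v i) + s)) > 0" using 2 by simp
    ultimately show False using assms(1) unfolding ma_stable_def
      by (elim conjE allE[of _ "\<lambda>i. cnj (of_real (v i) + s)"]) blast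
  qed
qed

text \<open>
  By real-rootedness only negative roots \<open>t = - s\<close> have to be excluded, which leaves a condition
  on a real half-line.
\<close>

lemma in_ma_cone_iff:
  assumes "ma_stable k c"
  shows "in_ma_cone c v \<longleftrightarrow> (\<forall>s>0. ma_eval c (\<lambda>i. of_real (v i) + of_real s) \<noteq> 0)"
proof
  assume L: "in_ma_cone c v"
  show "\<forall>s>0. ma_eval c (\<lambda>i. of_real (v i) + of_real s) \<noteq> 0"
  proof (intro allI impI notI)
    fix s :: real assume "s > 0" and "ma_eval c (\<lambda>i. of_real (v i) + of_real s) = 0"
    then have "ma_eval c (\<lambda>i. of_real (v i) - of_real (- s)) = 0" by simp
    then have "complex_of_real (- s) \<in> \<real>\<^sub>\<ge>\<^sub>0" using L unfolding in_ma_cone_def by blast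
    then show False using \<open>s > 0\<close> by (simp add: complex_nonneg_Reals_iff)
  qed
next
  assume R: "\<forall>s>0. ma_eval c (\<lambda>i. of_real (v i) + of_real s) \<noteq> 0"
  show "in_ma_cone c v" unfolding in_ma_cone_def
  proof (intro allI impI)
    fix t assume t: "ma_eval c (\<lambda>i. of_real (v i) - t) = 0"
    then have im: "Im t = 0"
      using ma_eval_real_root[OF assms, of v "- t"] by simp
    then have "of_real (Re t) = t" by (simp add: complex_eq_iff)
    then have "ma_eval c (\<lambda>i. of_real (v i) + of_real (- Re t)) = 0" using t by simp
    then have "\<not> - Re t > 0" using R by blast
    then show "t \<in> \<real>\<^sub>\<ge>\<^sub>0" using im by (simp add: complex_nonneg_Reals_iff)
  qed
qed

text \<open>
  By homogeneity, the value at \<open>\<i>\<one>\<close>, where stability applies, is \<open>\<i>\<^sup>k\<close> times the value at \<open>\<one>\<close>.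
\<close>

lemma sum_coeffs_nonzero:
  assumes "ma_stable k c"
  shows "(\<Sum>J\<in>UNIV. c J) \<noteq> 0"
proof
  assume 0: "(\<Sum>J\<in>UNIV. c J) = 0"
  have "ma_eval c (\<lambda>_. \<i>) = (\<Sum>J\<in>UNIV. of_real (c J) * \<i> ^ k)"
    unfolding ma_eval_def
  proof (rule sum.cong[OF refl])
    fix J show "complex_of_real (c J) * (\<Prod>i\<in>J. \<i>) = of_real (c J) * \<i> ^ k"
      using assms by (cases "c J = 0") (auto simp: ma_stable_def)
  qed
  also have "\<dots> = of_real (\<Sum>J\<in>UNIV. c J) * \<i> ^ k" by (simp add: sum_distrib_right)
  finally have "ma_eval c (\<lambda>_. \<i>) = 0" using 0 by simp
  then show False using assms by (auto simp: ma_stable_def)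
qed

section \<open>Lazy transpositions preserve stability\<close>

lemma convex_square: "((1 - t) * a + t * b)\<^sup>2 \<le> (1 - t) * a\<^sup>2 + t * b\<^sup>2"
  if "0 \<le> t" "t \<le> 1" for a b t :: real
proof -
  have "(1 - t) * a\<^sup>2 + t * b\<^sup>2 - ((1 - t) * a + t * b)\<^sup>2 = t * (1 - t) * (a - b)\<^sup>2"
    by (simp add: power2_eq_square algebra_simps)
  moreover have "t * (1 - t) * (a - b)\<^sup>2 \<ge> 0" using that by simp
  ultimately show ?thesis by linarith
qed

text \<open>
  The substitution \<open>x = r + 1 / u\<close> turns the upper half plane into the region
  \<open>Im u - Im r * \<bar>u\<bar>\<^sup>2 < 0\<close>.  For \<open>Im r \<le> 0\<close> the left-hand side is a convex function of \<open>u\<close>, so the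
  region is convex: a disc if \<open>Im r < 0\<close>, a half plane if \<open>r\<close> is real.
\<close>

lemma Im_inverse_shift:
  assumes "u \<noteq> 0"
  shows "Im (r + 1 / u) > 0 \<longleftrightarrow> Im u - Im r * (cmod u)\<^sup>2 < 0"
proof -
  have pos: "(cmod u)\<^sup>2 > 0" using assms by simp
  have "Im (1 / u) * (cmod u)\<^sup>2 = - Im u"
    using pos by (simp add: Im_divide cmod_power2)
  then have "Im (r + 1 / u) * (cmod u)\<^sup>2 = Im r * (cmod u)\<^sup>2 - Im u"
    by (simp add: ring_distribs)
  then show ?thesis using zero_less_mult_iff[of "Im (r + 1 / u)" "(cmod u)\<^sup>2"] pos by auto
qed

lemma convex_inverted_half_plane:
  fixes u w r :: complex and t :: real
  assumes "Im r \<le> 0" "0 \<le> t" "t \<le> 1"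
    and "Im u - Im r * (cmod u)\<^sup>2 < 0" "Im w - Im r * (cmod w)\<^sup>2 < 0"
  defines "U \<equiv> of_real (1 - t) * u + of_real t * w"
  shows "Im U - Im r * (cmod U)\<^sup>2 < 0"
proof -
  have "(cmod U)\<^sup>2 \<le> (1 - t) * (cmod u)\<^sup>2 + t * (cmod w)\<^sup>2"
    using convex_square[OF assms(2,3), of "Re u" "Re w"] convex_square[OF assms(2,3), of "Im u" "Im w"]
    unfolding U_def cmod_power2 by (simp add: algebra_simps)
  then have "(- Im r) * (cmod U)\<^sup>2 \<le> (- Im r) * ((1 - t) * (cmod u)\<^sup>2 + t * (cmod w)\<^sup>2)"
    using assms(1) by (intro mult_left_mono) auto
  then have "Im U - Im r * (cmod U)\<^sup>2 \<le>
      (1 - t) * (Im u - Im r * (cmod u)\<^sup>2) + t * (Im w - Im r * (cmod w)\<^sup>2)"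
    unfolding U_def by (simp add: algebra_simps)
  also have "\<dots> < 0"
    using convex_bound_lt[OF assms(4,5), of "1 - t" t] assms(2,3) by simp
  finally show ?thesis .
qed

text \<open>
  When \<open>d = 0\<close>, the average equals the value of \<open>f\<close> at the averaged arguments, which stay in the
  half plane.  The general case reduces to this one: \<open>f(t, t)\<close> has a zero \<open>r\<close>, necessarily outside
  the open upper half plane, and after the substitution \<open>x = r + 1 / u\<close>, \<open>y = r + 1 / w\<close> the
  coefficient of \<open>uw\<close> is \<open>f(r, r) = 0\<close>, while \<open>u\<close> and \<open>w\<close> range over a convex region.
\<close>

lemma biaffine_lazy_swap_nonzero:
  fixes a b c d x y :: complex and t :: real
  defines "f \<equiv> \<lambda>x y. a + b * x + c * y + d * (x * y)"
  assumes nz: "\<And>x y. Im x > 0 \<Longrightarrow> Im y > 0 \<Longrightarrow> f x y \<noteq> 0"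
    and t: "0 \<le> t" "t \<le> 1" and x: "Im x > 0" and y: "Im y > 0"
  shows "of_real (1 - t) * f x y + of_real t * f y x \<noteq> 0"
proof
  assume zero: "of_real (1 - t) * f x y + of_real t * f y x = 0"
  \<comment> \<open>For \<open>r = 0\<close> the convex region is the lower half plane; the signs move it to the upper one.\<close>
  have mix: "Im (of_real (1 - t) * p + of_real t * q) > 0" if "Im p > 0" "Im q > 0" for p q
    using convex_inverted_half_plane[of 0 t "- p" "- q"] that t by simp
  show False
  proof (cases "d = 0")
    case True
    have "f (of_real (1 - t) * x + of_real t * y) (of_real (1 - t) * y + of_real t * x) =
        of_real (1 - t) * f x y + of_real t * f y x"
      unfolding f_def using True by (simp add: algebra_simps)
    then show False using nz[OF mix[OF x y] mix[OF y x]] zero by simp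
  next
    case False
    \<comment> \<open>A root of \<open>d t\<^sup>2 + (b + c) t + a\<close>, the restriction of \<open>f\<close> to the diagonal.\<close>
    define r where "r = (- (b + c) + csqrt ((b + c)\<^sup>2 - 4 * a * d)) / (2 * d)"
    have "2 * d * r = - (b + c) + csqrt ((b + c)\<^sup>2 - 4 * a * d)"
      using False by (simp add: r_def)
    then have "(2 * d * r + (b + c))\<^sup>2 = (b + c)\<^sup>2 - 4 * a * d" by simp
    then have "4 * d * f r r = 0" unfolding f_def by (simp add: power2_eq_square algebra_simps)
    then have frr: "f r r = 0" using False by simp
    then have r: "Im r \<le> 0" using nz[of r r] by force
    have shift: "f (r + 1 / u) (r + 1 / w) * (u * w) = (b + d * r) * w + (c + d * r) * u + d"
      if "u \<noteq> 0" "w \<noteq> 0" for u w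
    proof -
      have "f (r + 1 / u) (r + 1 / w) * (u * w) =
          f r r * (u * w) + (b + d * r) * w + (c + d * r) * u + d"
        unfolding f_def using that by (simp add: field_simps)
      then show ?thesis using frr by simp
    qed
    define u w where "u = 1 / (x - r)" and "w = 1 / (y - r)"
    have "x \<noteq> r" "y \<noteq> r" using x y r by auto
    then have uw0: "u \<noteq> 0" "w \<noteq> 0" and xu: "r + 1 / u = x" and yw: "r + 1 / w = y"
      by (auto simp: u_def w_def)
    have u: "Im u - Im r * (cmod u)\<^sup>2 < 0" and w: "Im w - Im r * (cmod w)\<^sup>2 < 0"
      using Im_inverse_shift[OF uw0(1), of r] Im_inverse_shift[OF uw0(2), of r] x y xu yw by auto
    define U W where "U = of_real (1 - t) * u + of_real t * w"
      and "W = of_real (1 - t) * w + of_real t * u"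
    have U: "Im U - Im r * (cmod U)\<^sup>2 < 0" and W: "Im W - Im r * (cmod W)\<^sup>2 < 0"
      unfolding U_def W_def using convex_inverted_half_plane[OF r t] u w by auto
    then have UW0: "U \<noteq> 0" "W \<noteq> 0" by auto
    have "f (r + 1 / U) (r + 1 / W) * (U * W) =
        of_real (1 - t) * (f x y * (u * w)) + of_real t * (f y x * (w * u))"
      using shift[OF UW0] shift[OF uw0] shift[OF uw0(2,1)] unfolding xu yw
      by (simp add: U_def W_def algebra_simps)
    also have "\<dots> = (of_real (1 - t) * f x y + of_real t * f y x) * (u * w)"
      by (simp add: algebra_simps)
    finally have "f (r + 1 / U) (r + 1 / W) = 0" using zero UW0 by simp
    then show False using nz Im_inverse_shift UW0 U W by blast
  qed
qed

lemma ma_eval_biaffine: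
  fixes c :: "'n::finite set \<Rightarrow> real"
  assumes "p \<noteq> q"
  obtains A B C D where
    "\<And>x y. ma_eval c (z(p := x, q := y)) = A + B * x + C * y + D * (x * y)"
proof -
  define g where "g J = of_real (c J) * (\<Prod>i\<in>J - {p, q}. z i)" for J
  define S where "S P = (\<Sum>J\<in>UNIV. if P (p \<in> J) (q \<in> J) then g J else 0)" for P :: "bool \<Rightarrow> bool \<Rightarrow> bool"
  have "ma_eval c (z(p := x, q := y)) =
      S (\<lambda>i j. \<not> i \<and> \<not> j) + S (\<lambda>i j. i \<and> \<not> j) * x + S (\<lambda>i j. \<not> i \<and> j) * y + S (\<lambda>i j. i \<and> j) * (x * y)"
    for x y
    unfolding ma_eval_def S_def sum_distrib_right sum.distrib[symmetric]
  proof (rule sum.cong[OF refl])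
    fix J :: "'n set"
    let ?z = "z(p := x, q := y)"
    have "(\<Prod>i\<in>J. ?z i) = (\<Prod>i\<in>J - {p, q}. ?z i) * (\<Prod>i\<in>J \<inter> {p, q}. ?z i)"
      by (subst prod.Int_Diff[of J _ "{p, q}"]) auto
    also have "(\<Prod>i\<in>J - {p, q}. ?z i) = (\<Prod>i\<in>J - {p, q}. z i)"
      by (rule prod.cong) auto
    also have "(\<Prod>i\<in>J \<inter> {p, q}. ?z i) = (if p \<in> J then x else 1) * (if q \<in> J then y else 1)"
      using assms by (auto simp: Int_insert_right)
    finally have P: "(\<Prod>i\<in>J. ?z i) = (\<Prod>i\<in>J - {p, q}. z i) *
        ((if p \<in> J then x else 1) * (if q \<in> J then y else 1))" .
    show "of_real (c J) * (\<Prod>i\<in>J. ?z i) =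
        (if \<not> p \<in> J \<and> \<not> q \<in> J then g J else 0) + (if p \<in> J \<and> \<not> q \<in> J then g J else 0) * x +
        (if \<not> p \<in> J \<and> q \<in> J then g J else 0) * y + (if p \<in> J \<and> q \<in> J then g J else 0) * (x * y)"
      unfolding P by (auto simp: g_def)
  qed
  then show thesis by (rule that)
qed

lemma ma_stable_lazy_swap:
  assumes st: "ma_stable k c" and t: "0 \<le> t" "t \<le> 1" and pq: "p \<noteq> q"
  shows "ma_stable k (lazy_swap t p q c)"
  unfolding ma_stable_def
proof (intro conjI allI impI)
  fix J assume "lazy_swap t p q c J \<noteq> 0"
  then have "c J \<noteq> 0 \<or> c (swap p q ` J) \<noteq> 0" by (auto simp: lazy_swap_def)
  moreover have "card (swap p q ` J) = card J"
    by (rule card_image) (rule inj_on_subset[OF inj_transpose], simp)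
  ultimately show "card J = k" using st unfolding ma_stable_def by metis
next
  fix z :: "'a \<Rightarrow> complex" assume z: "\<forall>i. Im (z i) > 0"
  obtain A B C D where f:
    "\<And>x y. ma_eval c (z(p := x, q := y)) = A + B * x + C * y + D * (x * y)"
    using ma_eval_biaffine[OF pq] by blast
  have nz: "A + B * x + C * y + D * (x * y) \<noteq> 0" if "Im x > 0" "Im y > 0" for x y
    using st z that unfolding ma_stable_def f[symmetric] by auto
  have "z = z(p := z p, q := z q)" "z \<circ> swap p q = z(p := z q, q := z p)"
    using pq by (auto simp: fun_eq_iff Transposition.transpose_def)
  then have "ma_eval c z = A + B * z p + C * z q + D * (z p * z q)"
    "ma_eval c (z \<circ> swap p q) = A + B * z q + C * z p + D * (z q * z p)"
    using f by metis+
  then show "ma_eval (lazy_swap t p q c) z \<noteq> 0"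
    unfolding ma_eval_lazy_swap
    using biaffine_lazy_swap_nonzero[OF nz t, of "z p" "z q"] z by simp
qed

section \<open>Real-rooted pencils of polynomials\<close>

text \<open>
  Such a polynomial is a product of factors \<open>s - r\<close> with \<open>r < 0\<close>, and multiplication by
  such a factor keeps coefficients positive.
\<close>

lemma coeffs_pos_of_negative_roots:
  fixes p :: "complex poly"
  assumes "lead_coeff p = 1" and "\<And>z. poly p z = 0 \<Longrightarrow> Im z = 0 \<and> Re z < 0"
  shows "j \<le> degree p \<Longrightarrow> Im (coeff p j) = 0 \<and> Re (coeff p j) > 0"
  using assms
proof (induction "degree p" arbitrary: p j)
  case 0
  then show ?case by auto
next
  case (Suc n)
  have "\<not> constant (poly p)" using Suc.hyps(2) by (simp add: Fundamental_Theorem_Algebra.constant_degree)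
  then obtain r where r: "poly p r = 0" using fundamental_theorem_of_algebra by blast
  then obtain q where p: "p = [:- r, 1:] * q" using poly_eq_0_iff_dvd by (metis dvdE)
  have q0: "q \<noteq> 0" using Suc.hyps(2) p by auto
  have deg: "degree p = Suc (degree q)"
    unfolding p using q0 by (subst degree_mult_eq) auto
  have lq: "lead_coeff q = 1" using Suc.prems(2) unfolding p by (simp add: lead_coeff_mult del: mult_pCons_left)
  have IH: "Im (coeff q i) = 0 \<and> Re (coeff q i) > 0" if "i \<le> degree q" for i
    using Suc.hyps(1)[of q i] that deg Suc.hyps(2) lq Suc.prems(3) unfolding p by simp
  \<comment> \<open>Beyond the degree coefficients are zero, so only a weak inequality holds for every index.\<close>
  have IH': "Im (coeff q i) = 0 \<and> Re (coeff q i) \<ge> 0" for i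
    using IH[of i] by (cases "i \<le> degree q") (auto simp: coeff_eq_0 not_le)
  have rneg: "Im r = 0" "Re r < 0" using Suc.prems(3) r by auto
  have pj: "coeff p j = - r * coeff q j + (case j of 0 \<Rightarrow> 0 | Suc i \<Rightarrow> coeff q i)"
    unfolding p by (simp add: coeff_pCons)
  show ?case
  proof (cases j)
    case 0
    then show ?thesis using pj IH[of 0] rneg by (simp add: mult_neg_pos)
  next
    case (Suc i)
    then have "i \<le> degree q" using Suc.prems(1) deg by simp
    moreover have "- (Re r * Re (coeff q j)) \<ge> 0"
      using rneg IH'[of j] by (simp add: mult_nonpos_nonneg)
    ultimately show ?thesis using pj Suc IH[of i] IH'[of j] rneg by simp
  qed
qed

definition no_nonneg_root :: "complex poly \<Rightarrow> bool" where
  "no_nonneg_root p \<longleftrightarrow> (\<forall>s\<ge>0. poly p (of_real s) \<noteq> 0)"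

lemma coeffs_pos_of_no_nonneg_root:
  assumes lead: "lead_coeff p = 1" and real: "\<And>z. poly p z = 0 \<Longrightarrow> Im z = 0"
    and no: "no_nonneg_root p" and "j \<le> degree p"
  shows "Re (coeff p j) > 0"
proof -
  have "Im z = 0 \<and> Re z < 0" if z: "poly p z = 0" for z
  proof -
    have "Im z = 0" by (rule real[OF z])
    then have "of_real (Re z) = z" by (simp add: complex_eq_iff)
    then have "\<not> Re z \<ge> 0" using no z unfolding no_nonneg_root_def by auto
    then show ?thesis using \<open>Im z = 0\<close> by simp
  qed
  then show ?thesis using coeffs_pos_of_negative_roots[OF lead, of j] assms(4) by blast
qed

lemma no_nonneg_root_of_coeffs:
  assumes "\<And>j. j \<le> degree p \<Longrightarrow> Re (coeff p j) \<ge> 0" and "Re (coeff p 0) > 0"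
  shows "no_nonneg_root p"
  unfolding no_nonneg_root_def
proof (intro allI impI)
  fix s :: real assume s: "s \<ge> 0"
  have "Re (poly p (of_real s)) = (\<Sum>j\<le>degree p. Re (coeff p j) * s ^ j)"
    unfolding poly_altdef by (simp flip: of_real_power)
  also have "\<dots> \<ge> (\<Sum>j\<in>{0}. Re (coeff p j) * s ^ j)"
    by (rule sum_mono2) (use s assms(1) in auto)
  finally have "Re (poly p (of_real s)) > 0" using assms(2) by simp
  then show "poly p (of_real s) \<noteq> 0" by auto
qed

abbreviation pmix :: "real \<Rightarrow> complex poly \<Rightarrow> complex poly \<Rightarrow> complex poly" where
  "pmix t p q \<equiv> smult (of_real (1 - t)) p + smult (of_real t) q"

lemma pmix_monic:
  assumes "degree p = k" "degree q = k" "lead_coeff p = 1" "lead_coeff q = 1"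
  shows "degree (pmix t p q) = k" "lead_coeff (pmix t p q) = 1"
proof -
  have c: "coeff (pmix t p q) k = 1" using assms by auto
  have "degree (pmix t p q) \<le> k"
    using assms by (intro degree_add_le order.trans[OF degree_smult_le]) auto
  then show d: "degree (pmix t p q) = k" using c le_degree[of "pmix t p q" k] by simp
  show "lead_coeff (pmix t p q) = 1" using c d by simp
qed

text \<open>
  Moving linearly from \<open>r\<close> to \<open>q\<close>, the constant coefficient stays positive.  If some
  coefficient of \<open>q\<close> were not positive, look at the first time \<open>t\<close> at which a coefficient vanishes.
  There all coefficients are still nonnegative and the constant one is positive, so there is no
  nonnegative root; but then real-rootedness makes all coefficients strictly positive.
\<close>

lemma no_nonneg_root_along_pencil:
  assumes deg: "degree r = k" "degree q = k" and lead: "lead_coeff r = 1" "lead_coeff q = 1"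
    and real: "\<And>t z. 0 \<le> t \<Longrightarrow> t \<le> 1 \<Longrightarrow> poly (pmix t r q) z = 0 \<Longrightarrow> Im z = 0"
    and r: "no_nonneg_root r" and q0: "Re (coeff q 0) > 0"
  shows "no_nonneg_root q"
proof -
  have pos: "Re (coeff (pmix t r q) j) > 0"
    if "0 \<le> t" "t \<le> 1" "no_nonneg_root (pmix t r q)" "j \<le> k" for t j
    using coeffs_pos_of_no_nonneg_root[OF pmix_monic(2)[OF deg lead] real[OF that(1,2)] that(3)]
      pmix_monic(1)[OF deg lead] that(4) by simp
  define a b where "a j = Re (coeff r j)" and "b j = Re (coeff q j)" for j
  have mix: "Re (coeff (pmix t r q) j) = (1 - t) * a j + t * b j" for t j
    by (simp add: a_def b_def)
  have a: "a j > 0" if "j \<le> k" for j using pos[of 0 j] r that by (simp add: a_def)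
  have "\<forall>j\<le>k. b j > 0"
  proof (rule ccontr)
    assume "\<not> (\<forall>j\<le>k. b j > 0)"
    then have ne: "{j. j \<le> k \<and> b j \<le> 0} \<noteq> {}" by (auto simp: not_less)
    have fin: "finite {j. j \<le> k \<and> b j \<le> 0}" by (rule finite_subset[of _ "{..k}"]) auto
    \<comment> \<open>The time at which the \<open>j\<close>-th coefficient \<open>(1 - t) a\<^sub>j + t b\<^sub>j\<close> vanishes.\<close>
    define \<tau> where "\<tau> j = a j / (a j - b j)" for j
    obtain j0 where j0: "j0 \<le> k" "b j0 \<le> 0"
      and least: "\<And>j. j \<le> k \<Longrightarrow> b j \<le> 0 \<Longrightarrow> \<tau> j0 \<le> \<tau> j"
      using arg_min_if_finite[OF fin ne, of \<tau>] by (smt (verit) mem_Collect_eq)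
    define t where "t = \<tau> j0"
    have t: "0 \<le> t" "t \<le> 1" using a[OF j0(1)] j0(2) by (auto simp: t_def \<tau>_def field_simps)
    have crossing: "(1 - t) * a j0 + t * b j0 = 0"
      using a[OF j0(1)] j0(2) by (simp add: t_def \<tau>_def field_simps)
    have nn: "(1 - t) * a j + t * b j \<ge> 0" if "j \<le> k" for j
    proof (cases "b j \<le> 0")
      case True
      have "t \<le> a j / (a j - b j)" using least[OF that True] by (simp add: t_def \<tau>_def)
      then have "t * (a j - b j) \<le> a j" using a[OF that] True by (simp add: pos_le_divide_eq)
      then show ?thesis by (simp add: algebra_simps)
    next
      case False
      then show ?thesis using t a[OF that] by simp
    qed
    have "(1 - t) * a 0 + t * b 0 > 0"
    proof (cases "t = 0")
      case True
      then show ?thesis using a[of 0] by simp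
    next
      case False
      then have "t * b 0 > 0" using t q0 by (simp add: b_def)
      moreover have "(1 - t) * a 0 \<ge> 0" using t a[of 0] by simp
      ultimately show ?thesis by linarith
    qed
    then have "no_nonneg_root (pmix t r q)"
      using nn pmix_monic(1)[OF deg lead, of t] by (intro no_nonneg_root_of_coeffs) (simp_all only: mix)
    then have "(1 - t) * a j0 + t * b j0 > 0" using pos[OF t _ j0(1)] by (simp only: mix)
    then show False using crossing by simp
  qed
  then show ?thesis
    using q0 deg(2) by (intro no_nonneg_root_of_coeffs) (auto simp: b_def less_imp_le)
qed

text \<open>
  The constant coefficient is positive at the parameter \<open>\<theta>\<close> and affine in the parameter, hence
  positive at one of the endpoints; the pencil from \<open>\<theta>\<close> to that endpoint carries the property over.
\<close>

lemma no_nonneg_root_endpoint: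
  assumes deg: "degree p = k" "degree q = k" and lead: "lead_coeff p = 1" "lead_coeff q = 1"
    and real: "\<And>t z. 0 \<le> t \<Longrightarrow> t \<le> 1 \<Longrightarrow> poly (pmix t p q) z = 0 \<Longrightarrow> Im z = 0"
    and \<theta>: "0 \<le> \<theta>" "\<theta> \<le> 1" and r: "no_nonneg_root (pmix \<theta> p q)"
  shows "no_nonneg_root p \<or> no_nonneg_root q"
proof -
  let ?r = "pmix \<theta> p q"
  note m = pmix_monic[OF deg lead, of \<theta>]
  have toq: "pmix t ?r q = pmix (\<theta> + t * (1 - \<theta>)) p q" for t
    by (rule poly_eqI) (simp add: algebra_simps)
  have top: "pmix t ?r p = pmix (\<theta> - t * \<theta>) p q" for t
    by (rule poly_eqI) (simp add: algebra_simps)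
  have rangeq: "0 \<le> \<theta> + t * (1 - \<theta>)" "\<theta> + t * (1 - \<theta>) \<le> 1" if "0 \<le> t" "t \<le> 1" for t
  proof -
    show "0 \<le> \<theta> + t * (1 - \<theta>)" using \<theta> that by simp
    have "t * (1 - \<theta>) \<le> 1 * (1 - \<theta>)" using \<theta> that by (intro mult_right_mono) auto
    then show "\<theta> + t * (1 - \<theta>) \<le> 1" by simp
  qed
  have rangep: "0 \<le> \<theta> - t * \<theta>" "\<theta> - t * \<theta> \<le> 1" if "0 \<le> t" "t \<le> 1" for t
  proof -
    have "t * \<theta> \<le> 1 * \<theta>" "0 \<le> t * \<theta>" using \<theta> that by (auto simp: mult_left_le_one_le)
    then show "0 \<le> \<theta> - t * \<theta>" "\<theta> - t * \<theta> \<le> 1" using \<theta> by auto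
  qed
  have "Re (coeff ?r 0) > 0"
    by (rule coeffs_pos_of_no_nonneg_root[OF m(2) real[OF \<theta>] r]) simp_all
  then have "(1 - \<theta>) * Re (coeff p 0) + \<theta> * Re (coeff q 0) > 0" by simp
  then consider "Re (coeff p 0) > 0" | "Re (coeff q 0) > 0"
    using \<theta> by (smt (verit) mult_nonneg_nonpos)
  then show ?thesis
  proof cases
    case 1
    then have "no_nonneg_root p"
      using no_nonneg_root_along_pencil[OF m(1) deg(1) m(2) lead(1) _ r 1] real rangep
      unfolding top by blast
    then show ?thesis ..
  next
    case 2
    then have "no_nonneg_root q"
      using no_nonneg_root_along_pencil[OF m(1) deg(2) m(2) lead(2) _ r 2] real rangeq
      unfolding toq by blast
    then show ?thesis ..
  qed
qed

section \<open>One lazy transposition and the cone\<close>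

text \<open>
  The restriction of the polynomial to the line \<open>v + s\<one>\<close>.  Division by the value at \<open>\<one>\<close>, which is
  the coefficient of \<open>s\<^sup>k\<close> in the homogeneous case of degree \<open>k\<close>, makes it monic.  A transposition
  does not change that value, so a lazy transposition acts on normalized restrictions by the
  same convex combination.
\<close>

definition line_poly :: "('n::finite set \<Rightarrow> real) \<Rightarrow> ('n \<Rightarrow> real) \<Rightarrow> complex poly" where
  "line_poly c v = (\<Sum>J\<in>UNIV. smult (of_real (c J / (\<Sum>K\<in>UNIV. c K))) (\<Prod>i\<in>J. [:of_real (v i), 1:]))"

lemma poly_line_poly:
  "poly (line_poly c v) s = ma_eval c (\<lambda>i. of_real (v i) + s) / of_real (\<Sum>K\<in>UNIV. c K)"
  by (simp add: line_poly_def ma_eval_def poly_sum poly_prod sum_divide_distrib)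

lemma line_poly_monic:
  assumes "ma_stable k c"
  shows "degree (line_poly c v) = k" "lead_coeff (line_poly c v) = 1"
proof -
  let ?s = "\<Sum>K\<in>UNIV. c K"
  let ?P = "\<lambda>J. \<Prod>i\<in>J. [:complex_of_real (v i), 1:]"
  have s: "?s \<noteq> 0" by (rule sum_coeffs_nonzero[OF assms])
  have dP: "degree (?P J) = card J" for J
    by (subst degree_prod_eq_sum_degree) auto
  have lP: "lead_coeff (?P J) = 1" for J by (simp add: lead_coeff_prod)
  have "degree (line_poly c v) \<le> k"
    unfolding line_poly_def
  proof (rule degree_sum_le)
    fix J :: "'a set"
    show "degree (smult (of_real (c J / ?s)) (?P J)) \<le> k"
      using assms dP[of J] by (cases "c J = 0") (auto simp: ma_stable_def)
  qed simp
  moreover have c: "coeff (line_poly c v) k = 1"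
  proof -
    have "coeff (line_poly c v) k = (\<Sum>J\<in>UNIV. of_real (c J / ?s))"
      unfolding line_poly_def coeff_sum
    proof (rule sum.cong[OF refl])
      fix J :: "'a set"
      show "coeff (smult (of_real (c J / ?s)) (?P J)) k = of_real (c J / ?s)"
        using assms dP[of J] lP[of J] by (cases "c J = 0") (auto simp: ma_stable_def)
    qed
    also have "\<dots> = of_real (\<Sum>J\<in>UNIV. c J / ?s)" by simp
    also have "(\<Sum>J\<in>UNIV. c J / ?s) = 1" using s by (simp flip: sum_divide_distrib)
    finally show ?thesis by simp
  qed
  ultimately show "degree (line_poly c v) = k"
    using le_degree[of "line_poly c v" k] by simp
  then show "lead_coeff (line_poly c v) = 1" using c by simp
qed

lemma sum_transpose_image: "(\<Sum>J\<in>UNIV. c (swap a b ` J)) = (\<Sum>J\<in>UNIV. (c J :: real))"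
  for c :: "'n::finite set \<Rightarrow> real"
  by (rule sum.reindex_bij_witness[of _ "image (swap a b)" "image (swap a b)"])
     (auto simp: image_image)

lemma sum_lazy_swap: "(\<Sum>J\<in>UNIV. lazy_swap t a b c J) = (\<Sum>J\<in>UNIV. c J)"
  for c :: "'n::finite set \<Rightarrow> real"
proof -
  have "(\<Sum>J\<in>UNIV. lazy_swap t a b c J) =
      (1 - t) * (\<Sum>J\<in>UNIV. c J) + t * (\<Sum>J\<in>UNIV. c (swap a b ` J))"
    by (simp add: lazy_swap_def sum.distrib sum_distrib_left)
  then show ?thesis by (simp add: sum_transpose_image algebra_simps)
qed

lemma line_poly_lazy_swap:
  "poly (line_poly (lazy_swap t a b c) v) s =
   poly (pmix t (line_poly c v) (line_poly c (v \<circ> swap a b))) s"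
  by (simp add: poly_line_poly sum_lazy_swap ma_eval_lazy_swap comp_def add_divide_distrib)

lemma no_nonneg_root_line_poly:
  assumes "ma_stable k c"
  shows "no_nonneg_root (line_poly c v) \<longleftrightarrow> (\<forall>s\<ge>0. ma_eval c (\<lambda>i. of_real (v i) + of_real s) \<noteq> 0)"
  using sum_coeffs_nonzero[OF assms] by (auto simp: no_nonneg_root_def poly_line_poly simp flip: of_real_sum)

text \<open>
  The pencil argument excludes the root \<open>0\<close> as well, whereas points of the cone may have
  it.  It is therefore applied to \<open>v + \<epsilon>\<one>\<close> with \<open>\<epsilon> > 0\<close>.  If both conclusions failed, with positive
  zeros \<open>s1\<close> and \<open>s2\<close>, then \<open>\<epsilon> = min s1 s2\<close> would give a contradiction.
\<close>

lemma in_ma_cone_lazy_swap: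
  assumes st: "ma_stable k c" and t: "0 \<le> t" "t \<le> 1" and pq: "p \<noteq> q"
    and v: "in_ma_cone (lazy_swap t p q c) v"
  shows "in_ma_cone c v \<or> in_ma_cone c (v \<circ> swap p q)"
proof -
  let ?w = "\<lambda>\<epsilon> i. v i + \<epsilon>"
  have comp: "?w \<epsilon> \<circ> swap p q = (\<lambda>i. (v \<circ> swap p q) i + \<epsilon>)" for \<epsilon>
    by (simp add: comp_def)
  have key: "no_nonneg_root (line_poly c (?w \<epsilon>)) \<or>
      no_nonneg_root (line_poly c (\<lambda>i. (v \<circ> swap p q) i + \<epsilon>))" if \<epsilon>: "\<epsilon> > 0" for \<epsilon>
    unfolding comp[symmetric]
  proof (rule no_nonneg_root_endpoint[OF _ _ _ _ _ t])
    fix u :: real and z assume u: "0 \<le> u" "u \<le> 1"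
      and "poly (pmix u (line_poly c (?w \<epsilon>)) (line_poly c (?w \<epsilon> \<circ> swap p q))) z = 0"
    then have "poly (line_poly (lazy_swap u p q c) (?w \<epsilon>)) z = 0"
      by (simp only: line_poly_lazy_swap)
    then have "ma_eval (lazy_swap u p q c) (\<lambda>i. of_real (?w \<epsilon> i) + z) = 0"
      using sum_coeffs_nonzero[OF ma_stable_lazy_swap[OF st u pq]]
      by (simp add: poly_line_poly flip: of_real_sum)
    then show "Im z = 0" using ma_eval_real_root[OF ma_stable_lazy_swap[OF st u pq], of "?w \<epsilon>"] by blast
  next
    have "no_nonneg_root (line_poly (lazy_swap t p q c) (?w \<epsilon>))"
      unfolding no_nonneg_root_line_poly[OF ma_stable_lazy_swap[OF st t pq]]
    proof (intro allI impI)
      fix s :: real assume "s \<ge> 0"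
      then have "\<epsilon> + s > 0" using \<epsilon> by simp
      then have "ma_eval (lazy_swap t p q c) (\<lambda>i. of_real (v i) + of_real (\<epsilon> + s)) \<noteq> 0"
        using v unfolding in_ma_cone_iff[OF ma_stable_lazy_swap[OF st t pq]] by blast
      then show "ma_eval (lazy_swap t p q c) (\<lambda>i. of_real (?w \<epsilon> i) + of_real s) \<noteq> 0"
        by (simp add: add.assoc)
    qed
    then show "no_nonneg_root (pmix t (line_poly c (?w \<epsilon>)) (line_poly c (?w \<epsilon> \<circ> swap p q)))"
      unfolding no_nonneg_root_def by (simp only: line_poly_lazy_swap)
  qed (use line_poly_monic[OF st] in auto)
  show ?thesis
  proof (rule ccontr)
    assume "\<not> ?thesis"
    then obtain s1 s2 where s: "s1 > 0" "s2 > 0"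
      and z1: "ma_eval c (\<lambda>i. of_real (v i) + of_real s1) = 0"
      and z2: "ma_eval c (\<lambda>i. of_real ((v \<circ> swap p q) i) + of_real s2) = 0"
      unfolding in_ma_cone_iff[OF st] by blast
    define \<epsilon> where "\<epsilon> = min s1 s2"
    have "\<epsilon> > 0" "s1 - \<epsilon> \<ge> 0" "s2 - \<epsilon> \<ge> 0" using s by (auto simp: \<epsilon>_def)
    moreover have "ma_eval c (\<lambda>i. of_real (?w \<epsilon> i) + of_real (s1 - \<epsilon>)) = 0"
      using z1 by simp
    moreover have "ma_eval c (\<lambda>i. of_real ((v \<circ> swap p q) i + \<epsilon>) + of_real (s2 - \<epsilon>)) = 0"
      using z2 by simp
    ultimately show False
      using key[of \<epsilon>] unfolding no_nonneg_root_line_poly[OF st] by blast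
  qed
qed

section \<open>Symmetrization by lazy transpositions\<close>

text \<open>
  The relation that every chain of lazy transpositions from \<open>c\<close> to \<open>d\<close> satisfies.  It is stated
  through its consequence for the cones, which is transitive, so that no chains have to be
  recorded.
\<close>

definition sym_reduct :: "nat \<Rightarrow> ('n::finite set \<Rightarrow> real) \<Rightarrow> ('n set \<Rightarrow> real) \<Rightarrow> bool" where
  "sym_reduct k c d \<longleftrightarrow> ma_stable k d \<and>
     (\<forall>v. in_ma_cone d v \<longrightarrow> (\<exists>\<sigma>. bij \<sigma> \<and> in_ma_cone c (v \<circ> \<sigma>)))"

definition sym_on :: "'n set \<Rightarrow> ('n set \<Rightarrow> real) \<Rightarrow> bool" where
  "sym_on S c \<longleftrightarrow> (\<forall>a\<in>S. \<forall>b\<in>S. \<forall>J. c (swap a b ` J) = c J)"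

lemma sym_reduct_refl: "ma_stable k c \<Longrightarrow> sym_reduct k c c"
  unfolding sym_reduct_def by (metis bij_id comp_id)

lemma sym_reduct_trans:
  assumes "sym_reduct k c d" "sym_reduct k d e"
  shows "sym_reduct k c e"
  unfolding sym_reduct_def
proof (intro conjI allI impI)
  show "ma_stable k e" using assms(2) by (simp add: sym_reduct_def)
  fix v assume "in_ma_cone e v"
  then obtain \<sigma> where \<sigma>: "bij \<sigma>" "in_ma_cone d (v \<circ> \<sigma>)" using assms(2) by (auto simp: sym_reduct_def)
  then obtain \<rho> where "bij \<rho>" "in_ma_cone c (v \<circ> \<sigma> \<circ> \<rho>)" using assms(1) by (auto simp: sym_reduct_def)
  then show "\<exists>\<sigma>. bij \<sigma> \<and> in_ma_cone c (v \<circ> \<sigma>)" using \<sigma>(1) by (metis bij_comp comp_assoc)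
qed

lemma sym_reduct_lazy_swap:
  assumes "ma_stable k c" "0 \<le> t" "t \<le> 1" "p \<noteq> q"
  shows "sym_reduct k c (lazy_swap t p q c)"
  unfolding sym_reduct_def
proof (intro conjI allI impI)
  show "ma_stable k (lazy_swap t p q c)" by (rule ma_stable_lazy_swap[OF assms])
  fix v assume "in_ma_cone (lazy_swap t p q c) v"
  then consider "in_ma_cone c (v \<circ> id)" | "in_ma_cone c (v \<circ> swap p q)"
    using in_ma_cone_lazy_swap[OF assms] by auto
  then show "\<exists>\<sigma>. bij \<sigma> \<and> in_ma_cone c (v \<circ> \<sigma>)"
  proof cases
    case 1
    then show ?thesis by (intro exI[of _ id] conjI bij_id)
  next
    case 2
    then show ?thesis by (intro exI[of _ "swap p q"] conjI bij_transpose)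
  qed
qed

text \<open>
  Conjugation of \<open>(j m)\<close> by \<open>(i m)\<close> gives \<open>(i j)\<close>, which fixes \<open>m\<close>.  For a polynomial symmetric in
  the indices other than \<open>m\<close>, the factor \<open>(j m)\<close> in \<open>(i m)(j m)\<close> therefore has no effect.
\<close>

lemma transpose_conj_image:
  assumes "i \<noteq> m" "j \<noteq> m" "i \<noteq> j"
  shows "swap i m ` swap j m ` J = swap i j ` swap i m ` J"
proof -
  have "swap i m (swap j m x) = swap i j (swap i m x)" for x
    using assms by (auto simp: Transposition.transpose_def)
  then show ?thesis by (simp add: image_image)
qed

text \<open>
  The full symmetrization over \<open>insert m S\<close> of a polynomial symmetric in \<open>S\<close> averages over the
  coset representatives \<open>(i m)\<close>, \<open>i \<in> insert m S\<close>.  The lazy transpositions \<open>(j m)\<close>, \<open>j \<in> S\<close>, reach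
  it one after the other: the term \<open>(i m) c\<close> of an index \<open>i\<close> already treated is fixed by
  \<open>(j m)\<close>, so each step only moves weight \<open>1 / N\<close> from \<open>c\<close> to \<open>(j m) c\<close>.
\<close>

lemma symmetrize_insert:
  assumes st: "ma_stable k c" and sym: "sym_on S c" and fin: "finite S" and m: "m \<notin> S"
  defines "N \<equiv> real (card S + 1)"
  shows "sym_reduct k c (\<lambda>J. (\<Sum>i\<in>insert m S. c (swap i m ` J)) / N)"
proof -
  \<comment> \<open>The state after the indices in \<open>T\<close> have been treated.\<close>
  define g where "g T J = (1 - real (card T) / N) * c J + (\<Sum>i\<in>T. c (swap i m ` J)) / N" for T J
  have N: "N > 0" by (simp add: N_def)
  have "finite T \<Longrightarrow> T \<subseteq> S \<Longrightarrow> sym_reduct k c (g T)" for T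
  proof (induction T rule: finite_induct)
    case empty
    have "g {} = c" by (rule ext) (simp add: g_def)
    then show ?case using sym_reduct_refl[OF st] by simp
  next
    case (insert j T)
    have j: "j \<in> S" "j \<noteq> m" and T: "T \<subseteq> S" using insert.prems m by auto
    have "card T < card S"
      using insert.hyps insert.prems fin by (intro psubset_card_mono) auto
    then have NT: "N - real (card T) > 1" by (simp add: N_def)
    \<comment> \<open>The weight left on \<open>c\<close> is \<open>(N - card T) / N\<close>; the fraction \<open>t\<close> of it is \<open>1 / N\<close>.\<close>
    define t where "t = 1 / (N - real (card T))"
    have t: "0 \<le> t" "t \<le> 1" using NT by (auto simp: t_def)
    have IH: "sym_reduct k c (g T)" using insert.IH T by blast
    have "g (insert j T) J = lazy_swap t j m (g T) J" for J
    proof -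
      have fixed: "c (swap i m ` swap j m ` J) = c (swap i m ` J)" if "i \<in> T" for i
      proof -
        have "i \<noteq> m" "i \<in> S" "i \<noteq> j" using that T m insert.hyps by auto
        then show ?thesis using transpose_conj_image[of i m j J] j sym by (simp add: sym_on_def)
      qed
      have distribute: "(1 - t) * (x * y + w) + t * (x * y' + w) = (1 - t) * x * y + t * x * y' + w"
        for x y y' w :: real by (simp add: algebra_simps)
      have "(\<Sum>i\<in>T. c (swap i m ` swap j m ` J)) = (\<Sum>i\<in>T. c (swap i m ` J))"
        by (rule sum.cong[OF refl]) (rule fixed)
      then have "lazy_swap t j m (g T) J =
          (1 - t) * (1 - real (card T) / N) * c J + t * (1 - real (card T) / N) * c (swap j m ` J) +
          (\<Sum>i\<in>T. c (swap i m ` J)) / N"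
        unfolding lazy_swap_def g_def by (simp add: distribute del: times_divide_eq_right times_divide_eq_left)
      moreover have "t * (1 - real (card T) / N) = 1 / N"
        using NT N by (simp add: t_def field_simps)
      moreover from this have "(1 - t) * (1 - real (card T) / N) = 1 - real (card (insert j T)) / N"
        using insert.hyps by (simp add: left_diff_distrib add_divide_distrib)
      ultimately show ?thesis using insert.hyps by (simp add: g_def add_divide_distrib)
    qed
    then have "g (insert j T) = lazy_swap t j m (g T)" by blast
    moreover have "sym_reduct k (g T) (lazy_swap t j m (g T))"
      using IH t j by (intro sym_reduct_lazy_swap) (auto simp: sym_reduct_def)
    ultimately show ?case using sym_reduct_trans[OF IH] by simp
  qed
  then have "sym_reduct k c (g S)" using fin by blast
  moreover have "g S = (\<lambda>J. (\<Sum>i\<in>insert m S. c (swap i m ` J)) / N)"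
  proof
    fix J
    \<comment> \<open>The remaining weight of \<open>c\<close> itself is the summand for \<open>i = m\<close>.\<close>
    have "1 - real (card S) / N = 1 / N" using N by (simp add: N_def field_simps)
    then show "g S J = (\<Sum>i\<in>insert m S. c (swap i m ` J)) / N"
      using fin m by (simp add: g_def add_divide_distrib)
  qed
  ultimately show ?thesis by simp
qed

text \<open>
  A transposition of the enlarged index set permutes the summands: \<open>(a m)\<close> exchanges those for
  \<open>a\<close> and \<open>m\<close> and fixes the others, and \<open>(a b)\<close> with \<open>a, b \<in> S\<close> acts on the index \<open>i\<close>, up to the
  symmetry of \<open>c\<close>.
\<close>

lemma sym_on_insert:
  assumes sym: "sym_on S c" and m: "m \<notin> S"
  shows "sym_on (insert m S) (\<lambda>J. (\<Sum>i\<in>insert m S. c (swap i m ` J)) / N)"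
proof -
  let ?G = "\<lambda>J. \<Sum>i\<in>insert m S. c (swap i m ` J)"
  have with_m: "?G (swap a m ` J) = ?G J" if a: "a \<in> S" for a J
  proof (rule sum.reindex_bij_witness[of _ "swap a m" "swap a m"])
    fix i assume i: "i \<in> insert m S"
    show "c (swap (swap a m i) m ` J) = c (swap i m ` swap a m ` J)"
    proof (cases "i = m \<or> i = a")
      case True
      then show ?thesis by (auto simp: image_image)
    next
      case False
      then have "swap a m i = i" "i \<in> S" "i \<noteq> m" "a \<noteq> m" "i \<noteq> a" using i a m by (auto simp: Transposition.transpose_def)
      then show ?thesis using transpose_conj_image[of i m a J] a sym by (simp add: sym_on_def)
    qed
  qed (use a in \<open>auto simp: Transposition.transpose_def split: if_splits\<close>)
  have within: "?G (swap a b ` J) = ?G J" if ab: "a \<in> S" "b \<in> S" for a b J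
  proof (rule sum.reindex_bij_witness[of _ "swap a b" "swap a b"])
    fix i assume i: "i \<in> insert m S"
    have "m \<noteq> a" "m \<noteq> b" using ab m by auto
    then have "swap i m (swap a b x) = swap a b (swap (swap a b i) m x)" for x
      by (auto simp: Transposition.transpose_def)
    then have "swap i m ` swap a b ` J = swap a b ` swap (swap a b i) m ` J"
      by (simp add: image_image)
    then show "c (swap (swap a b i) m ` J) = c (swap i m ` swap a b ` J)"
      using ab sym by (simp add: sym_on_def)
  qed (use ab in \<open>auto simp: Transposition.transpose_def split: if_splits\<close>)
  have "?G (swap a b ` J) = ?G J" if ab: "a \<in> insert m S" "b \<in> insert m S" for a b J
  proof -
    consider "a = b" | "a = m" "b \<in> S" | "b = m" "a \<in> S" | "a \<in> S" "b \<in> S" using ab by blast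
    then show ?thesis
    proof cases
      case 2
      then show ?thesis using with_m[of b J] by (simp only: transpose_commute)
    qed (use with_m within in \<open>simp_all only: transpose_same image_id id_apply\<close>)
  qed
  then show ?thesis by (simp add: sym_on_def)
qed

lemma symmetrization_exists:
  assumes "finite S" "ma_stable k c"
  shows "\<exists>d. sym_reduct k c d \<and> sym_on S d"
  using assms(1)
proof (induction S rule: finite_induct)
  case empty
  then show ?case using sym_reduct_refl[OF assms(2)] by (auto simp: sym_on_def)
next
  case (insert m S)
  then obtain d where d: "sym_reduct k c d" "sym_on S d" by blast
  then have "ma_stable k d" by (simp add: sym_reduct_def)
  then show ?case
    using sym_reduct_trans[OF d(1) symmetrize_insert[OF _ d(2) insert.hyps(1,2)]]
      sym_on_insert[OF d(2) insert.hyps(2)] by blast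
qed

text \<open>Sets of equal cardinality are joined by exchanging one element at a time.\<close>

lemma sym_on_UNIV_card:
  fixes c :: "'n::finite set \<Rightarrow> real"
  assumes sym: "sym_on UNIV c"
  shows "card J = card K \<Longrightarrow> c J = c K"
proof (induction "card (J - K)" arbitrary: J)
  case 0
  then have "J \<subseteq> K" by simp
  then have "J = K" using 0 by (intro card_subset_eq) auto
  then show ?case by simp
next
  case (Suc n)
  then obtain a where a: "a \<in> J" "a \<notin> K"
    by (metis Diff_iff card_eq_0_iff equals0I nat.distinct(1))
  have "card (K - J) = card (J - K)"
    using Suc.prems card_le_sym_Diff[of J K] card_le_sym_Diff[of K J] by simp
  then obtain b where b: "b \<in> K" "b \<notin> J"
    using Suc.hyps(2) by (metis Diff_iff card_eq_0_iff equals0I nat.distinct(1))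
  let ?J = "swap a b ` J"
  have "?J = insert b (J - {a})"
    using a b by (force simp: Transposition.transpose_def image_iff)
  then have "?J - K = (J - K) - {a}" using a b by auto
  then have "card (?J - K) = n" using Suc.hyps(2) a by (simp add: card_Diff_singleton)
  moreover have "card ?J = card K"
    using Suc.prems by (simp add: card_image)
  ultimately have "c ?J = c K" using Suc.hyps(1)[of ?J] by simp
  then show ?case using sym by (simp add: sym_on_def)
qed

text \<open>
  The symmetrization \<open>d\<close> is constant on sets of cardinality \<open>k\<close> and zero elsewhere, hence a nonzero
  multiple of \<open>e\<^sub>k\<close> with the same cone.
\<close>

theorem in_ma_cone_permuted:
  fixes c :: "'n::finite set \<Rightarrow> real" and v :: "'n \<Rightarrow> real"
  assumes st: "ma_stable k c"
    and v: "in_ma_cone (\<lambda>J. if card J = k then 1 else 0) v"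
  shows "\<exists>\<sigma>. bij \<sigma> \<and> in_ma_cone c (v \<circ> \<sigma>)"
proof -
  obtain d where d: "sym_reduct k c d" "sym_on UNIV d"
    using symmetrization_exists[OF finite st] by blast
  then have sd: "ma_stable k d" by (simp add: sym_reduct_def)
  then have "d \<noteq> (\<lambda>_. 0)" using sum_coeffs_nonzero[OF sd] by auto
  then obtain K where K: "d K \<noteq> 0" by blast
  then have cK: "card K = k" using sd by (simp add: ma_stable_def)
  \<comment> \<open>The vanishing second summand gives the right-hand side the shape of \<open>ma_eval_lincomb\<close>.\<close>
  have "d J = d K * (if card J = k then 1 else 0) + 0 * d J" for J
    using sym_on_UNIV_card[OF d(2), of J K] cK sd by (auto simp: ma_stable_def)
  then have "d = (\<lambda>J. d K * (if card J = k then 1 else 0) + 0 * d J)" by blast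
  then have "ma_eval d z = of_real (d K) * ma_eval (\<lambda>J. if card J = k then 1 else 0) z +
      of_real 0 * ma_eval d z" for z
    by (subst ma_eval_lincomb[symmetric]) simp
  then have "ma_eval d z = of_real (d K) * ma_eval (\<lambda>J. if card J = k then 1 else 0) z" for z
    by simp
  then have "in_ma_cone d v" using v K by (simp add: in_ma_cone_def)
  then show ?thesis using d(1) by (simp add: sym_reduct_def)
qed

section \<open>Translation to polynomials\<close>

definition squarefree_mon :: "'n::finite set \<Rightarrow> 'n \<Rightarrow>\<^sub>0 nat" where
  "squarefree_mon J = (\<Sum>i\<in>J. Poly_Mapping.single i 1)"

lemma lookup_squarefree_mon: "Poly_Mapping.lookup (squarefree_mon J) i = (if i \<in> J then 1 else 0)"
  by (simp add: squarefree_mon_def lookup_sum lookup_single when_def)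

lemma inj_squarefree_mon: "inj (squarefree_mon :: 'n::finite set \<Rightarrow> _)"
proof (rule injI)
  fix J K :: "'n::finite set" assume "squarefree_mon J = squarefree_mon K"
  then have "(if i \<in> J then 1 else 0) = (if i \<in> K then 1 else (0::nat))" for i
    by (metis lookup_squarefree_mon)
  then show "J = K" by (metis subsetI subset_antisym zero_neq_one)
qed

lemma eval_rpoly_squarefree:
  assumes "Poly_Mapping.keys p \<subseteq> range squarefree_mon"
  shows "eval_rpoly p (\<chi> i. z i) = ma_eval (\<lambda>J. Poly_Mapping.lookup p (squarefree_mon J)) z"
proof -
  let ?f = "\<lambda>m. of_real (Poly_Mapping.lookup p m) * (\<Prod>i\<in>UNIV. z i ^ Poly_Mapping.lookup m i)"
  have "eval_rpoly p (\<chi> i. z i) = sum ?f (Poly_Mapping.keys p)" by (simp add: eval_rpoly_def)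
  also have "\<dots> = sum ?f (range squarefree_mon)"
    by (rule sum.mono_neutral_left) (use assms in \<open>auto simp: in_keys_iff\<close>)
  also have "\<dots> = (\<Sum>J\<in>UNIV. ?f (squarefree_mon J))"
    by (simp add: sum.reindex[OF inj_squarefree_mon])
  also have "\<dots> = ma_eval (\<lambda>J. Poly_Mapping.lookup p (squarefree_mon J)) z"
    unfolding ma_eval_def
  proof (rule sum.cong[OF refl])
    fix J
    have "(\<Prod>i\<in>UNIV. z i ^ Poly_Mapping.lookup (squarefree_mon J) i) = (\<Prod>i\<in>UNIV. if i \<in> J then z i else 1)"
      by (rule prod.cong) (auto simp: lookup_squarefree_mon)
    then show "?f (squarefree_mon J) = of_real (Poly_Mapping.lookup p (squarefree_mon J)) * (\<Prod>i\<in>J. z i)"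
      by (simp add: prod.If_cases)
  qed
  finally show ?thesis .
qed

lemma hyp_cone_squarefree:
  assumes "Poly_Mapping.keys p \<subseteq> range squarefree_mon"
  shows "v \<in> hyp_cone p \<longleftrightarrow> in_ma_cone (\<lambda>J. Poly_Mapping.lookup p (squarefree_mon J)) (\<lambda>i. v $ i)"
  by (simp add: hyp_cone_def in_ma_cone_def eval_rpoly_squarefree[OF assms])

lemma multiaffine_keys:
  assumes "multiaffine p"
  shows "Poly_Mapping.keys p \<subseteq> range squarefree_mon"
proof
  fix m assume m: "m \<in> Poly_Mapping.keys p"
  have "m = squarefree_mon {i. Poly_Mapping.lookup m i \<noteq> 0}"
  proof (rule poly_mapping_eqI)
    fix i
    have "Poly_Mapping.lookup m i \<le> 1" using assms m by (simp add: multiaffine_def)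
    then show "Poly_Mapping.lookup m i =
        Poly_Mapping.lookup (squarefree_mon {i. Poly_Mapping.lookup m i \<noteq> 0}) i"
      by (auto simp: lookup_squarefree_mon)
  qed
  then show "m \<in> range squarefree_mon" by blast
qed

lemma prod_Var: "(\<Prod>i\<in>J. Var i) = Poly_Mapping.single (squarefree_mon J) 1"
  for J :: "'n::finite set"
proof (induction J rule: finite_induct[OF finite])
  case 1
  then show ?case by (simp add: squarefree_mon_def)
next
  case (2 i J)
  then show ?case by (simp add: squarefree_mon_def Var_def mult_single)
qed

lemma lookup_elem_sym:
  "Poly_Mapping.lookup (elem_sym k :: ('n::finite) rpoly) m =
     (\<Sum>J | card J = k. if squarefree_mon J = m then 1 else 0)"
  by (simp add: elem_sym_def prod_Var lookup_sum lookup_single when_def)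

lemma lookup_elem_sym_squarefree:
  "Poly_Mapping.lookup (elem_sym k :: ('n::finite) rpoly) (squarefree_mon K) = (if card K = k then 1 else 0)"
proof -
  have "(squarefree_mon J = squarefree_mon K) = (J = K)" for J
    using inj_squarefree_mon by (auto dest: injD)
  then show ?thesis by (simp add: lookup_elem_sym)
qed

lemma keys_elem_sym: "Poly_Mapping.keys (elem_sym k :: ('n::finite) rpoly) \<subseteq> range squarefree_mon"
proof
  fix m :: "'n \<Rightarrow>\<^sub>0 nat" assume "m \<in> Poly_Mapping.keys (elem_sym k)"
  then have "(\<Sum>J | card J = k. if squarefree_mon J = m then 1 else (0::real)) \<noteq> 0"
    by (simp add: in_keys_iff lookup_elem_sym)
  then obtain J where "squarefree_mon J = m" by (metis (mono_tags, lifting) sum.neutral)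
  then show "m \<in> range squarefree_mon" by blast
qed

theorem theorem2p11:
  fixes h :: "('n::finite) rpoly" and k :: nat and v :: "real ^ 'n"
  assumes "h \<noteq> 0" and "homogeneous k h" and "multiaffine h" and "stable_rpoly h"
    and "v \<in> hyp_cone (elem_sym k)"
  shows "\<exists>\<tau>. \<tau> permutes UNIV \<and> perm_vec \<tau> v \<in> hyp_cone h"
proof -
  define c where "c J = Poly_Mapping.lookup h (squarefree_mon J)" for J
  have keys: "Poly_Mapping.keys h \<subseteq> range squarefree_mon"
    by (rule multiaffine_keys[OF assms(3)])
  have "card J = k" if "c J \<noteq> 0" for J
  proof -
    have "squarefree_mon J \<in> Poly_Mapping.keys h" using that by (simp add: c_def in_keys_iff)
    then have "(\<Sum>i\<in>UNIV. Poly_Mapping.lookup (squarefree_mon J) i) = k"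
      using assms(2) by (simp add: homogeneous_def)
    then show ?thesis by (simp add: lookup_squarefree_mon sum.If_cases)
  qed
  moreover have "ma_eval c z \<noteq> 0" if "\<forall>i. Im (z i) > 0" for z
    using assms(4) that eval_rpoly_squarefree[OF keys, of z] unfolding stable_rpoly_def c_def
    by (metis vec_lambda_beta)
  ultimately have st: "ma_stable k c" by (simp add: ma_stable_def)
  have "in_ma_cone (\<lambda>J. if card J = k then 1 else 0) (\<lambda>i. v $ i)"
    using assms(5) by (simp add: hyp_cone_squarefree[OF keys_elem_sym] lookup_elem_sym_squarefree)
  then obtain \<sigma> where \<sigma>: "bij \<sigma>" "in_ma_cone c ((\<lambda>i. v $ i) \<circ> \<sigma>)"
    using in_ma_cone_permuted[OF st] by blast
  \<comment> \<open>\<open>perm_vec\<close> composes with the inverse of its permutation.\<close>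
  have "perm_vec (inv \<sigma>) v \<in> hyp_cone h"
    using \<sigma> by (simp add: hyp_cone_squarefree[OF keys] perm_vec_def inv_inv_eq comp_def c_def[abs_def])
  moreover have "inv \<sigma> permutes UNIV" using \<sigma>(1) by (intro bij_imp_permutes bij_imp_bij_inv) auto
  ultimately show ?thesis by blast
qed

end
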